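(* Let $\alpha=\alpha_1\alpha_2\cdots\alpha_n$ be a word of positive integers. The SR algorithm does not terminate on $\alpha$ if and only if $s_{\alpha_1}s_{\alpha_2}\cdots s_{\alpha_n}$ is a reduced expression for the permutation $s_{\alpha_1}s_{\alpha_2}\cdots s_{\alpha_n}$, i.e. this permutation has length exactly $n$ (it cannot be written as a product of fewer than $n$ adjacent transpositions).
   Context: $s_i$ denotes the adjacent transposition $(i,i+1)$ of the positive integers. A cell is a pair $(i,j)$ of integers with $i\ge 1$, $j\ge 0$. A tower diagram is a finite set $\mathcal T$ of cells such that $(i,j)\in\mathcal T$ and $0\le k\le j$ imply $(i,k)\in\mathcal T$. The cell $(i,j)$ lies on the diagonal $x+y=i+j$. Sliding: for a positive integer $\alpha$, $\alpha^{\searrow}\mathcal T$ is computed by the procedure $P(\gamma,m)$ started at $\gamma=\alpha$, $m=1$: (S1) if no cell $(i,j)\in\mathcal T$ with $i\ge m$ lies on $x+y=\gamma-1$: (a) if $(\gamma,0)\notin\mathcal T$ the result is $\mathcal T\cup\{(\gamma,0)\}$; (b) if $(\gamma,0)\in\mathcal T$, $(\gamma,1)\notin\mathcal T$ the slide terminates (without result); (c) if $(\gamma,0),(\gamma,1)\in\mathcal T$, continue with $P(\gamma+1,\gamma+1)$. (S2) Otherwise let $i\ge m$ be smallest with $(i,\gamma-1-i)\in\mathcal T$: (a) if $(i,\gamma-i)\notin\mathcal T$ the result is $\mathcal T\cup\{(i,\gamma-i)\}$; (b) if $(i,\gamma-i)\in\mathcal T$, $(i,\gamma-i+1)\notin\mathcal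 T$ the slide terminates; (c) if both are in $\mathcal T$, continue with $P(\gamma+1,i+1)$. SR algorithm on a word $\alpha_1\cdots\alpha_n$: set $\mathcal T^{(0)}=\varnothing$ and successively $\mathcal T^{(k)}=\alpha_k^{\searrow}\mathcal T^{(k-1)}$ for $k=1,\dots,n$; the algorithm terminates if one of these slides terminates. *)

theory Defs
  imports "HOL-Combinatorics.Transposition"
begin

definition tower_diagram :: "(nat \<times> nat) set \<Rightarrow> bool" where
  "tower_diagram T \<longleftrightarrow> finite T \<and> (\<forall>(i, j) \<in> T. 1 \<le> i) \<and>
     (\<forall>i j k. (i, j) \<in> T \<longrightarrow> k \<le> j \<longrightarrow> (i, k) \<in> T)"

text \<open>
  \<open>meets_diag T \<gamma> m i\<close>: the tower in column \<open>i \<ge> m\<close> has a cell on the diagonal \<open>x + y = \<gamma> - 1\<close>.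
  It implies \<open>i < \<gamma>\<close>, so the subtraction \<open>\<gamma> - i\<close> below is never truncated.
\<close>

definition meets_diag :: "(nat \<times> nat) set \<Rightarrow> nat \<Rightarrow> nat \<Rightarrow> nat \<Rightarrow> bool" where
  "meets_diag T \<gamma> m i \<longleftrightarrow> m \<le> i \<and> (\<exists>j. (i, j) \<in> T \<and> i + j + 1 = \<gamma>)"

text \<open>
  The procedure \<open>P(\<gamma>, m)\<close> on \<open>T\<close>; \<open>None\<close> means that the slide terminates without result.
  The guard only makes the recursion well-founded. It is never the reason for \<open>None\<close> in
  the algorithm below, because slides of positive integers produce tower diagrams
  (lemma \<open>tower_diagram_slide\<close>).
\<close>

function slide_from :: "(nat \<times> nat) set \<Rightarrow> nat \<Rightarrow> nat \<Rightarrow> (nat \<times> nat) set option" where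
  "slide_from T \<gamma> m =
    (if \<not> tower_diagram T then None
     else if \<not> (\<exists>i. meets_diag T \<gamma> m i) then
       (if (\<gamma>, 0) \<notin> T then Some (T \<union> {(\<gamma>, 0)})
        else if (\<gamma>, 1) \<notin> T then None
        else slide_from T (\<gamma> + 1) (\<gamma> + 1))
     else
       (let i = (LEAST i. meets_diag T \<gamma> m i) in
        if (i, \<gamma> - i) \<notin> T then Some (T \<union> {(i, \<gamma> - i)})
        else if (i, \<gamma> - i + 1) \<notin> T then None
        else slide_from T (\<gamma> + 1) (i + 1)))"
  by pat_completeness auto

lemma card_diag_less:
  assumes "finite T" "(i, j) \<in> T" "i + j = (\<gamma>::nat)"
  shows "card {c \<in> T. \<gamma> + 1 \<le> fst c + snd c} < card {c \<in> T. \<gamma> \<le> fst c + snd c}"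
proof (rule psubset_card_mono)
  show "finite {c \<in> T. \<gamma> \<le> fst c + snd c}" using assms by simp
  have "(i, j) \<in> {c \<in> T. \<gamma> \<le> fst c + snd c}" "(i, j) \<notin> {c \<in> T. \<gamma> + 1 \<le> fst c + snd c}"
    using assms by auto
  moreover have "{c \<in> T. \<gamma> + 1 \<le> fst c + snd c} \<subseteq> {c \<in> T. \<gamma> \<le> fst c + snd c}" by auto
  ultimately show "{c \<in> T. \<gamma> + 1 \<le> fst c + snd c} \<subset> {c \<in> T. \<gamma> \<le> fst c + snd c}" by blast
qed

lemma Least_meets_diag:
  assumes "\<exists>i. meets_diag T \<gamma> m i"
  shows "meets_diag T \<gamma> m (LEAST i. meets_diag T \<gamma> m i)"
  using assms by (rule LeastI_ex)

termination slide_from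
proof (relation "measure (\<lambda>(T, \<gamma>, m). card {c \<in> T. \<gamma> \<le> fst c + snd c})", goal_cases)
  case 1
  show ?case by simp
next
  case (2 T \<gamma> m)
  then have "finite T" "(\<gamma>, 0) \<in> T" by (simp_all add: tower_diagram_def)
  from card_diag_less[OF this, of \<gamma>] show ?case by simp
next
  case (3 T \<gamma> m i)
  then have "meets_diag T \<gamma> m i" using Least_meets_diag[of T \<gamma> m] by simp
  then have "i + (\<gamma> - i) = \<gamma>" by (auto simp: meets_diag_def)
  moreover have "finite T" "(i, \<gamma> - i) \<in> T" using 3 by (simp_all add: tower_diagram_def)
  ultimately show ?case using card_diag_less[of T i "\<gamma> - i" \<gamma>] by simp
qed

declare slide_from.simps [simp del]

definition slide :: "nat \<Rightarrow> (nat \<times> nat) set \<Rightarrow> (nat \<times> nat) set option" where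
  "slide a T = slide_from T a 1"

definition SR :: "nat list \<Rightarrow> (nat \<times> nat) set option" where
  "SR w = foldl (\<lambda>r a. Option.bind r (slide a)) (Some {}) w"

definition SR_terminates :: "nat list \<Rightarrow> bool" where
  "SR_terminates w \<longleftrightarrow> SR w = None"

lemma tower_diagram_empty: "tower_diagram {}"
  by (simp add: tower_diagram_def)

lemma tower_diagram_slide_from:
  assumes "slide_from T \<gamma> m = Some T'" "1 \<le> \<gamma>"
  shows "tower_diagram T'"
  using assms
proof (induction T \<gamma> m rule: slide_from.induct)
  case (1 T \<gamma> m)
  have tow: "tower_diagram T"
    using "1.prems"(1) by (subst (asm) slide_from.simps) (auto split: if_splits)
  show ?case
  proof (cases "\<exists>i. meets_diag T \<gamma> m i")
    case False
    show ?thesis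
    proof (cases "(\<gamma>, 0) \<in> T")
      case True
      with tow False "1.prems"(1)
      have "(\<gamma>, 1) \<in> T" "slide_from T (\<gamma> + 1) (\<gamma> + 1) = Some T'"
        by (subst (asm) slide_from.simps, auto split: if_splits)+
      with "1.IH"(1) tow False True show ?thesis by simp
    next
      case out: False
      with tow False "1.prems"(1) have "T' = T \<union> {(\<gamma>, 0)}"
        by (subst (asm) slide_from.simps) auto
      with tow "1.prems"(2) show ?thesis by (auto simp: tower_diagram_def)
    qed
  next
    case ex: True
    define i where "i = (LEAST i. meets_diag T \<gamma> m i)"
    have i: "meets_diag T \<gamma> m i" unfolding i_def by (rule Least_meets_diag[OF ex])
    have step: "slide_from T \<gamma> m =
        (if (i, \<gamma> - i) \<notin> T then Some (T \<union> {(i, \<gamma> - i)})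
         else if (i, \<gamma> - i + 1) \<notin> T then None
         else slide_from T (\<gamma> + 1) (i + 1))"
      using tow ex by (subst slide_from.simps) (simp add: i_def[symmetric] Let_def)
    show ?thesis
    proof (cases "(i, \<gamma> - i) \<in> T")
      case True
      then have "(i, \<gamma> - i + 1) \<in> T" "slide_from T (\<gamma> + 1) (i + 1) = Some T'"
        using "1.prems"(1) step by (auto split: if_splits)
      with "1.IH"(2)[of i] tow ex True i_def show ?thesis by simp
    next
      case False
      then have T': "T' = T \<union> {(i, \<gamma> - i)}" using "1.prems"(1) step by simp
      obtain j where j: "(i, j) \<in> T" "\<gamma> - i = Suc j"
        using i by (auto simp: meets_diag_def)
      have "1 \<le> i" "\<And>k. k \<le> j \<Longrightarrow> (i, k) \<in> T"
        using tow j(1) by (auto simp: tower_diagram_def)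
      with tow T' j(2) show ?thesis
        by (auto simp: tower_diagram_def le_Suc_eq)
    qed
  qed
qed

lemma tower_diagram_slide:
  assumes "slide a T = Some T'" "1 \<le> a"
  shows "tower_diagram T'"
  using assms tower_diagram_slide_from by (simp add: slide_def)

definition adj_transp :: "nat \<Rightarrow> nat \<Rightarrow> nat" where
  "adj_transp i = transpose i (i + 1)"

definition word_perm :: "nat list \<Rightarrow> nat \<Rightarrow> nat" where
  "word_perm w = foldr (\<circ>) (map adj_transp w) id"

text \<open>
  Permutations of the positive integers are represented as maps on \<open>nat\<close> that fix \<open>0\<close>;
  therefore only the transpositions with positive index are allowed here. The value is
  meaningful for products of such transpositions.
\<close>

definition perm_length :: "(nat \<Rightarrow> nat) \<Rightarrow> nat" where
  "perm_length p = (LEAST k. \<exists>w. length w = k \<and> (\<forall>a\<in>set w. 1 \<le> a) \<and> word_perm w = p)"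

definition reduced_word :: "nat list \<Rightarrow> bool" where
  "reduced_word w \<longleftrightarrow> perm_length (word_perm w) = length w"

end

theory Submission
  imports Defs
begin

text \<open>
  Let \<open>h\<^sub>i\<close> be the height of column \<open>i\<close> of a tower diagram \<open>T\<close>, put
  \<open>C\<^sub>i = s\<^sub>i s\<^sub>i\<^sub>+\<^sub>1 \<dots>\<close> (\<open>h\<^sub>i\<close> factors) and let \<open>w(T)\<close> be the product \<open>\<dots> C\<^sub>3 C\<^sub>2 C\<^sub>1\<close>.
  The slide of \<open>\<gamma>\<close> moves \<open>s\<^sub>\<gamma>\<close> to the left through \<open>w(T) s\<^sub>\<gamma>\<close>: it commutes with \<open>C\<^sub>i\<close> if
  \<open>\<gamma> > i + h\<^sub>i\<close>, lengthens \<open>C\<^sub>i\<close> if \<open>\<gamma> = i + h\<^sub>i\<close>, cancels its last factor if \<open>\<gamma> = i + h\<^sub>i - 1\<close>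
  (the terminating case), and satisfies \<open>C\<^sub>i s\<^sub>\<gamma> = s\<^sub>\<gamma>\<^sub>+\<^sub>1 C\<^sub>i\<close> otherwise. So multiplication by \<open>s\<^sub>\<gamma>\<close>
  adds a cell if the slide succeeds and removes a cell if it terminates. Since
  \<open>w\<close> is injective, the length of \<open>w(T)\<close> is the number of cells of \<open>T\<close>.
\<close>

section \<open>Products of adjacent transpositions\<close>

lemma word_perm_Nil [simp]: "word_perm [] = id"
  by (simp add: word_perm_def)

lemma word_perm_Cons [simp]: "word_perm (a # w) = adj_transp a \<circ> word_perm w"
  by (simp add: word_perm_def)

lemma word_perm_append [simp]: "word_perm (v @ w) = word_perm v \<circ> word_perm w"
  by (induction v) (simp_all add: comp_assoc)

lemma adj_transp_apply:
  "adj_transp a x = (if x = a then Suc a else if x = Suc a then a else x)"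
  by (simp add: adj_transp_def transpose_def)

lemma adj_transp_involutory [simp]: "adj_transp a \<circ> adj_transp a = id"
  by (simp add: adj_transp_def)

lemma bij_word_perm: "bij (word_perm w)"
proof (induction w)
  case Nil
  show ?case by (simp only: word_perm_Nil bij_id)
next
  case (Cons a w)
  have "bij (adj_transp a)" by (rule o_bij) (rule adj_transp_involutory)+
  with Cons show ?case by (simp only: word_perm_Cons bij_comp)
qed

lemma word_perm_fixes: "\<forall>a\<in>set w. x < a \<Longrightarrow> word_perm w x = x"
  by (induction w) (auto simp: adj_transp_apply)

text \<open>A run of consecutive letters gives a cycle; this closed form turns the relations below
  into case checks on points.\<close>

lemma word_perm_upt_apply:
  "m \<le> n \<Longrightarrow>
    word_perm [m..<n] x = (if x = n then m else if m \<le> x \<and> x < n then Suc x else x)"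
proof (induction n arbitrary: x rule: dec_induct)
  case base
  show ?case by simp
next
  case (step n)
  then show ?case by (auto simp: adj_transp_apply)
qed

lemma word_perm_upt_commute:
  "m \<le> n \<Longrightarrow> n < \<gamma> \<Longrightarrow>
    word_perm [m..<n] \<circ> adj_transp \<gamma> = adj_transp \<gamma> \<circ> word_perm [m..<n]"
  by (rule ext) (auto simp: word_perm_upt_apply adj_transp_apply)

lemma word_perm_upt_shift:
  "m \<le> \<gamma> \<Longrightarrow> Suc \<gamma> < n \<Longrightarrow>
    word_perm [m..<n] \<circ> adj_transp \<gamma> = adj_transp (Suc \<gamma>) \<circ> word_perm [m..<n]"
  by (rule ext) (auto simp: word_perm_upt_apply adj_transp_apply)

lemma word_perm_upt_cancel:
  "m \<le> \<gamma> \<Longrightarrow> word_perm [m..<Suc \<gamma>] \<circ> adj_transp \<gamma> = word_perm [m..<\<gamma>]"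
  by (simp add: comp_assoc)

section \<open>Columns of a tower diagram\<close>

definition height :: "(nat \<times> nat) set \<Rightarrow> nat \<Rightarrow> nat" where
  "height T i = card {j. (i, j) \<in> T}"

text \<open>A column is finite and downward closed, hence an initial segment determined by its
  cardinality.\<close>

lemma mem_tower_iff:
  assumes "tower_diagram T"
  shows "(i, j) \<in> T \<longleftrightarrow> j < height T i"
proof -
  have fin: "finite {j. (i, j) \<in> T}"
    using assms finite_subset[of "{j. (i, j) \<in> T}" "snd ` T"]
    by (force simp: tower_diagram_def)
  have down: "k \<le> j \<Longrightarrow> (i, j) \<in> T \<Longrightarrow> (i, k) \<in> T" for j k
    using assms by (auto simp: tower_diagram_def)
  show ?thesis
  proof
    assume "(i, j) \<in> T"
    then have "{..j} \<subseteq> {j. (i, j) \<in> T}" using down by auto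
    from card_mono[OF fin this] show "j < height T i" by (simp add: height_def)
  next
    assume less: "j < height T i"
    show "(i, j) \<in> T"
    proof (rule ccontr)
      assume "(i, j) \<notin> T"
      then have "{j. (i, j) \<in> T} \<subseteq> {..<j}" using down by (auto simp: not_le[symmetric])
      from card_mono[OF _ this] less show False by (simp add: height_def)
    qed
  qed
qed

lemma height_eqI: "{j. (i, j) \<in> T} = {..<n} \<Longrightarrow> height T i = n"
  by (simp add: height_def)

lemma height_insert_other: "i \<noteq> fst c \<Longrightarrow> height (insert c T) i = height T i"
  by (cases c) (simp add: height_def)

lemma height_remove_other: "i \<noteq> fst c \<Longrightarrow> height (T - {c}) i = height T i"
  by (cases c) (simp add: height_def)

lemma height_insert_top:
  "tower_diagram T \<Longrightarrow> height (insert (i, height T i) T) i = Suc (height T i)"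
  by (rule height_eqI) (auto simp: mem_tower_iff)

lemma height_remove_top:
  "tower_diagram T \<Longrightarrow> height T i = Suc k \<Longrightarrow> height (T - {(i, k)}) i = k"
  by (rule height_eqI) (auto simp: mem_tower_iff)

lemma tower_diagram_remove_top:
  "tower_diagram T \<Longrightarrow> height T i = Suc k \<Longrightarrow> tower_diagram (T - {(i, k)})"
  unfolding tower_diagram_def[of "T - _"]
  by (auto simp: mem_tower_iff) (auto simp: tower_diagram_def mem_tower_iff[symmetric])

section \<open>The reading word\<close>

text \<open>Diagonals are bounded rather than columns: a new cell lies on the diagonal of the
  current letter, so slides of letters up to \<open>D\<close> preserve the bound.\<close>

definition within :: "nat \<Rightarrow> (nat \<times> nat) set \<Rightarrow> bool" where
  "within D T \<longleftrightarrow> (\<forall>(i, j) \<in> T. i + j \<le> D)"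

text \<open>The reading word of columns \<open>m, \<dots>, D\<close>, rightmost column first, each from bottom to top.\<close>

definition tower_word :: "nat \<Rightarrow> (nat \<times> nat) set \<Rightarrow> nat \<Rightarrow> nat list" where
  "tower_word D T m = concat (map (\<lambda>i. [i..<i + height T i]) (rev [m..<Suc D]))"

lemma tower_word_rec:
  "m \<le> D \<Longrightarrow> tower_word D T m = tower_word D T (Suc m) @ [m..<m + height T m]"
  by (simp add: tower_word_def upt_conv_Cons[of m "Suc D"] del: upt_Suc)

lemma tower_word_cong:
  "(\<And>i. m \<le> i \<Longrightarrow> height T i = height T' i) \<Longrightarrow> tower_word D T m = tower_word D T' m"
  by (auto simp: tower_word_def simp del: upt_Suc intro!: arg_cong[where f = concat])

lemma tower_word_ge: "a \<in> set (tower_word D T m) \<Longrightarrow> m \<le> a"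
  by (auto simp: tower_word_def)

lemma length_tower_word:
  assumes "tower_diagram T" "within D T"
  shows "length (tower_word D T 1) = card T"
proof -
  have "T = Sigma {1..<Suc D} (\<lambda>i. {..<height T i})"
    using assms by (fastforce simp: mem_tower_iff[symmetric] tower_diagram_def within_def)
  then have "card T = card (Sigma {1..<Suc D} (\<lambda>i. {..<height T i}))" by simp
  also have "\<dots> = (\<Sum>i\<in>{1..<Suc D}. height T i)" by (subst card_SigmaI) auto
  also have "\<dots> = length (tower_word D T 1)"
    by (simp add: tower_word_def length_concat comp_def rev_map[symmetric]
        interv_sum_list_conv_sum_set_nat del: upt_Suc)
  finally show ?thesis by simp
qed

section \<open>Slides as right multiplication\<close>

text \<open>Together with the next lemma, this replaces the search for the least column by a scan of
  one column at a time.\<close>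

lemma slide_from_skip:
  assumes "m < \<gamma>" "(m, \<gamma> - 1 - m) \<notin> T"
  shows "slide_from T \<gamma> m = slide_from T \<gamma> (Suc m)"
proof -
  have "\<not> meets_diag T \<gamma> m m" using assms by (auto simp: meets_diag_def)
  then have eq: "meets_diag T \<gamma> m = meets_diag T \<gamma> (Suc m)"
    by (intro ext) (auto simp: meets_diag_def Suc_le_eq le_less)
  show ?thesis
    unfolding slide_from.simps[of T \<gamma> m] slide_from.simps[of T \<gamma> "Suc m"] by (simp only: eq)
qed

text \<open>For \<open>m < \<gamma>\<close> column \<open>m\<close> has a cell on the diagonal
  \<open>\<gamma> - 1\<close>, so it is the least column met. For \<open>m = \<gamma>\<close> no
  column is met, and (S1) takes the same form because \<open>\<gamma> - m = 0\<close>.\<close>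

lemma slide_from_hit:
  assumes "tower_diagram T" "m \<le> \<gamma>" "\<gamma> \<le> m + height T m"
  shows "slide_from T \<gamma> m =
    (if (m, \<gamma> - m) \<notin> T then Some (insert (m, \<gamma> - m) T)
     else if (m, \<gamma> - m + 1) \<notin> T then None
     else slide_from T (Suc \<gamma>) (Suc m))"
proof (cases "m = \<gamma>")
  case True
  moreover from this have "\<not> (\<exists>i. meets_diag T \<gamma> m i)" by (auto simp: meets_diag_def)
  ultimately show ?thesis using assms(1) by (subst slide_from.simps) simp
next
  case False
  then have "m < \<gamma> \<and> (m, \<gamma> - 1 - m) \<in> T" using assms by (auto simp: mem_tower_iff)
  then have "meets_diag T \<gamma> m m" by (auto simp: meets_diag_def intro!: exI[of _ "\<gamma> - 1 - m"])
  moreover from this have "(LEAST i. meets_diag T \<gamma> m i) = m"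
    by (intro Least_equality) (auto simp: meets_diag_def)
  ultimately show ?thesis using assms(1) by (subst slide_from.simps) (auto simp: Let_def)
qed

text \<open>Induction on the number of columns from \<open>m\<close> to \<open>D\<close>. For
  \<open>None\<close> the witness is the top cell of its column, so deleting it leaves a tower
  diagram.\<close>

lemma slide_from_word_perm:
  assumes "tower_diagram T" "within D T" "m \<le> \<gamma>" "\<gamma> \<le> D"
  shows "case slide_from T \<gamma> m of
      Some T' \<Rightarrow> \<exists>c. c \<notin> T \<and> m \<le> fst c \<and> fst c + snd c \<le> D \<and> T' = insert c T \<and>
        word_perm (tower_word D T' m) = word_perm (tower_word D T m) \<circ> adj_transp \<gamma>
    | None \<Rightarrow> \<exists>c. c \<in> T \<and> m \<le> fst c \<and> tower_diagram (T - {c}) \<and>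
        word_perm (tower_word D (T - {c}) m) = word_perm (tower_word D T m) \<circ> adj_transp \<gamma>"
  using assms(3,4)
proof (induction "Suc D - m" arbitrary: m \<gamma>)
  case 0
  then show ?case by simp
next
  case (Suc n)
  have mD: "m \<le> D" using Suc.prems by simp
  define h where "h = height T m"
  let ?C = "word_perm [m..<m + h]"
  have mem: "(m, j) \<in> T \<longleftrightarrow> j < h" for j
    unfolding h_def by (rule mem_tower_iff[OF assms(1)])
  have pT: "word_perm (tower_word D T m) = word_perm (tower_word D T (Suc m)) \<circ> ?C"
    using tower_word_rec[OF mD, of T] by (simp add: h_def)
  \<comment> \<open>The letter crosses column \<open>m\<close>, leaving it intact, and reaches the
    remaining columns as \<open>\<delta>\<close>, which is \<open>\<gamma>\<close> or
    \<open>\<gamma> + 1\<close>.\<close>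
  have pass: ?case
    if eq: "slide_from T \<gamma> m = slide_from T \<delta> (Suc m)" and \<delta>: "Suc m \<le> \<delta>" "\<delta> \<le> D"
      and comm: "?C \<circ> adj_transp \<gamma> = adj_transp \<delta> \<circ> ?C" for \<delta>
  proof -
    have lift: "word_perm (tower_word D T' m) = word_perm (tower_word D T m) \<circ> adj_transp \<gamma>"
      if "height T' m = h"
        "word_perm (tower_word D T' (Suc m)) = word_perm (tower_word D T (Suc m)) \<circ> adj_transp \<delta>"
      for T'
      using tower_word_rec[OF mD, of T'] that by (simp add: pT comp_assoc comm)
    note IH = Suc.hyps(1)[of "Suc m" \<delta>, OF _ \<delta>]
    show ?thesis
    proof (cases "slide_from T \<delta> (Suc m)")
      case None
      with IH Suc.hyps(2) obtain c where c: "c \<in> T" "Suc m \<le> fst c" "tower_diagram (T - {c})"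
        "word_perm (tower_word D (T - {c}) (Suc m)) =
          word_perm (tower_word D T (Suc m)) \<circ> adj_transp \<delta>"
        by fastforce
      with lift[of "T - {c}"] have
        "word_perm (tower_word D (T - {c}) m) = word_perm (tower_word D T m) \<circ> adj_transp \<gamma>"
        by (simp add: height_remove_other h_def)
      with c None eq show ?thesis by (simp del: split_paired_Ex) (rule exI[of _ c], simp)
    next
      case (Some T')
      with IH Suc.hyps(2) obtain c where c: "c \<notin> T" "Suc m \<le> fst c" "fst c + snd c \<le> D"
        "T' = insert c T"
        "word_perm (tower_word D T' (Suc m)) =
          word_perm (tower_word D T (Suc m)) \<circ> adj_transp \<delta>"
        by fastforce
      with lift[of T'] have
        "word_perm (tower_word D T' m) = word_perm (tower_word D T m) \<circ> adj_transp \<gamma>"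
        by (simp add: height_insert_other h_def)
      with c Some eq show ?thesis by (simp del: split_paired_Ex) (rule exI[of _ c], simp)
    qed
  qed
  \<comment> \<open>The change happens in column \<open>m\<close> itself, the rightmost
    factor.\<close>
  have top: "word_perm (tower_word D T' m) = word_perm (tower_word D T m) \<circ> adj_transp \<gamma>"
    if "\<And>i. Suc m \<le> i \<Longrightarrow> height T' i = height T i"
      "word_perm [m..<m + height T' m] = ?C \<circ> adj_transp \<gamma>" for T'
    using tower_word_rec[OF mD, of T'] tower_word_cong[of "Suc m" T' T D] that
    by (simp add: pT comp_assoc)
  consider "m + h < \<gamma>" | "\<gamma> = m + h" | "Suc \<gamma> = m + h" | "Suc \<gamma> < m + h" by linarith
  then show ?case
  proof cases
    case 1
    then show ?thesis
      using slide_from_skip[of m \<gamma> T] Suc.prems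
      by (intro pass[of \<gamma>]) (auto simp: mem word_perm_upt_commute)
  next
    case 2
    let ?T' = "insert (m, h) T"
    have "slide_from T \<gamma> m = Some ?T'"
      using slide_from_hit[OF assms(1), of m \<gamma>] 2 by (auto simp: mem h_def)
    moreover have "word_perm (tower_word D ?T' m) = word_perm (tower_word D T m) \<circ> adj_transp \<gamma>"
      using 2 height_insert_top[OF assms(1), of m]
      by (intro top) (simp_all add: height_insert_other h_def)
    ultimately show ?thesis
      using 2 Suc.prems by (simp del: split_paired_Ex) (rule exI[of _ "(m, h)"], simp add: mem)
  next
    case 3
    define k where "k = \<gamma> - m"
    have k: "h = Suc k" "\<gamma> = m + k" using 3 Suc.prems by (auto simp: k_def)
    have "slide_from T \<gamma> m = None"
      using slide_from_hit[OF assms(1), of m \<gamma>] k by (auto simp: mem h_def)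
    moreover have "word_perm (tower_word D (T - {(m, k)}) m) =
        word_perm (tower_word D T m) \<circ> adj_transp \<gamma>"
      using k height_remove_top[OF assms(1), of m k] word_perm_upt_cancel[of m \<gamma>]
      by (intro top) (simp_all add: height_remove_other h_def)
    moreover have "tower_diagram (T - {(m, k)})"
      using tower_diagram_remove_top[OF assms(1)] k by (simp add: h_def)
    ultimately show ?thesis
      using k by (simp del: split_paired_Ex) (rule exI[of _ "(m, k)"], simp add: mem)
  next
    case 4
    \<comment> \<open>This cell of \<open>T\<close> on the diagonal \<open>\<gamma> + 1\<close>
      shows that the raised letter is still at most \<open>D\<close>.\<close>
    then have "(m, Suc \<gamma> - m) \<in> T" using Suc.prems by (auto simp: mem)
    then have "Suc \<gamma> \<le> D" using assms(2) Suc.prems by (auto simp: within_def)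
    moreover have "slide_from T \<gamma> m = slide_from T (Suc \<gamma>) (Suc m)"
      using slide_from_hit[OF assms(1), of m \<gamma>] 4 Suc.prems by (auto simp: mem h_def)
    ultimately show ?thesis
      using 4 Suc.prems by (intro pass[of "Suc \<gamma>"]) (auto simp: word_perm_upt_shift)
  qed
qed

section \<open>Injectivity of the reading word\<close>

text \<open>
  The columns left of \<open>m\<close> being stripped off, the height of column \<open>m\<close> is read off from the
  preimage \<open>m + height T m\<close> of \<open>m\<close>.
\<close>

lemma word_perm_tower_word_height:
  assumes "word_perm (tower_word D T m) = word_perm (tower_word D T' m)" "m \<le> i" "i \<le> D"
  shows "height T i = height T' i"
  using assms(1,2)
proof (induction "i - m" arbitrary: m)
  have apply_top: "word_perm (tower_word D U m) (m + height U m) = m" if "m \<le> D" for U m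
  proof -
    \<comment> \<open>Letters of the columns right of \<open>m\<close> exceed \<open>m\<close>; only
      the cycle of column \<open>m\<close> moves it.\<close>
    have "word_perm (tower_word D U (Suc m)) m = m"
      by (rule word_perm_fixes) (auto dest: tower_word_ge)
    with tower_word_rec[OF that, of U] show ?thesis by (simp add: word_perm_upt_apply)
  qed
  have eq: "height T m = height T' m"
    if "word_perm (tower_word D T m) = word_perm (tower_word D T' m)" "m \<le> D" for m
  proof -
    have "word_perm (tower_word D T m) (m + height T m) =
        word_perm (tower_word D T m) (m + height T' m)"
      using apply_top[of m T] apply_top[of m T'] that by simp
    then show ?thesis using bij_is_inj[OF bij_word_perm] by (simp add: inj_eq)
  qed
  {
    case 0
    then show ?case using eq[of m] assms(3) by simp
  next
    case (Suc n)
    then have mD: "m \<le> D" using assms(3) by simp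
    let ?C = "word_perm [m..<m + height T m]"
    have comp: "word_perm (tower_word D T (Suc m)) \<circ> ?C =
        word_perm (tower_word D T' (Suc m)) \<circ> ?C"
      using Suc.prems(1) eq[OF Suc.prems(1) mD] by (simp add: tower_word_rec[OF mD])
    have "word_perm (tower_word D T (Suc m)) = word_perm (tower_word D T' (Suc m))"
    proof
      fix x
      obtain y where "x = ?C y" using bij_is_surj[OF bij_word_perm] by (rule surjE)
      with fun_cong[OF comp, of y]
      show "word_perm (tower_word D T (Suc m)) x = word_perm (tower_word D T' (Suc m)) x"
        by simp
    qed
    then show ?case using Suc.hyps(1)[of "Suc m"] Suc.hyps(2) by simp
  }
qed

text \<open>The permutation determines the heights of columns \<open>1\<close> to \<open>D\<close>,
  and all other columns are empty.\<close>

lemma tower_eqI: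
  assumes "tower_diagram T" "within D T" "tower_diagram T'" "within D T'"
    and "word_perm (tower_word D T 1) = word_perm (tower_word D T' 1)"
  shows "T = T'"
proof -
  have "c \<in> U \<longleftrightarrow> 1 \<le> fst c \<and> fst c \<le> D \<and> snd c < height U (fst c)"
    if "tower_diagram U" "within D U" for U c
    using that mem_tower_iff[OF that(1), of "fst c" "snd c"]
    by (auto simp: tower_diagram_def within_def)
  with assms(1-4) word_perm_tower_word_height[OF assms(5)] show ?thesis
    by (intro set_eqI) auto
qed

section \<open>The SR algorithm and reducedness\<close>

lemma SR_Nil [simp]: "SR [] = Some {}"
  by (simp add: SR_def)

lemma SR_snoc [simp]: "SR (w @ [a]) = Option.bind (SR w) (slide a)"
  by (simp add: SR_def)

text \<open>After termination \<open>T\<close> is no output of the algorithm: each slide without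
  result deletes the cancelled cell instead. The deficit of cells persists, since a later letter
  adds at most one.\<close>

lemma SR_word_perm:
  assumes "\<forall>a\<in>set w. 1 \<le> a \<and> a \<le> D"
  shows "\<exists>T. tower_diagram T \<and> within D T \<and>
    word_perm (tower_word D T 1) = word_perm w \<and>
    (if SR w = None then card T < length w else SR w = Some T \<and> card T = length w)"
  using assms
proof (induction w rule: rev_induct)
  case Nil
  have "tower_word D {} 1 = []"
    by (simp add: tower_word_def height_def concat_eq_Nil_conv del: upt_Suc)
  then show ?case
    by (intro exI[of _ "{}"]) (simp add: tower_diagram_empty within_def)
next
  case (snoc a w)
  from snoc obtain T where T: "tower_diagram T" "within D T"
    "word_perm (tower_word D T 1) = word_perm w"
    "if SR w = None then card T < length w else SR w = Some T \<and> card T = length w"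
    by fastforce
  have a: "1 \<le> a" "a \<le> D" using snoc.prems by auto
  have fin: "finite T" using T(1) by (simp add: tower_diagram_def)
  note step = slide_from_word_perm[OF T(1,2) a, folded slide_def]
  show ?case
  proof (cases "slide a T")
    case None
    with step obtain c where c: "c \<in> T" "tower_diagram (T - {c})"
      "word_perm (tower_word D (T - {c}) 1) = word_perm (tower_word D T 1) \<circ> adj_transp a"
      by auto
    have "SR (w @ [a]) = None" using T(4) None by (auto split: if_splits)
    moreover have "card (T - {c}) < length (w @ [a])"
      using T(4) card_Diff1_le[of T c] by (auto split: if_splits)
    ultimately show ?thesis
      using c T(2,3) by (intro exI[of _ "T - {c}"]) (auto simp: within_def)
  next
    case (Some T')
    with step obtain c where c: "c \<notin> T" "fst c + snd c \<le> D" "T' = insert c T"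
      "word_perm (tower_word D T' 1) = word_perm (tower_word D T 1) \<circ> adj_transp a"
      by auto
    have "tower_diagram T'" using tower_diagram_slide[OF Some a(1)] .
    moreover have "within D T'" using T(2) c by (auto simp: within_def)
    moreover have "card T' = Suc (card T)" using c fin by simp
    ultimately show ?thesis
      using c(4) T(3,4) Some by (intro exI[of _ T']) (auto split: if_splits)
  qed
qed

theorem theorem4p3:
  fixes \<alpha> :: "nat list"
  assumes "\<forall>a\<in>set \<alpha>. 1 \<le> a"
  shows "\<not> SR_terminates \<alpha> \<longleftrightarrow> reduced_word \<alpha>"
proof
  assume nt: "\<not> SR_terminates \<alpha>"
  have "length \<alpha> \<le> length v" if v: "\<forall>a\<in>set v. 1 \<le> a" "word_perm v = word_perm \<alpha>" for v
  proof -
    \<comment> \<open>A common bound makes the two diagrams comparable; the \<open>0\<close> keeps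
      the set nonempty for empty words.\<close>
    define D where "D = Max (set (0 # \<alpha> @ v))"
    have le: "a \<le> D" if "a \<in> set \<alpha> \<union> set v" for a
      unfolding D_def using that by (intro Max_ge) auto
    obtain T where T: "tower_diagram T" "within D T"
      "word_perm (tower_word D T 1) = word_perm \<alpha>" "card T = length \<alpha>"
      using SR_word_perm[of \<alpha> D] assms le nt by (auto simp: SR_terminates_def)
    \<comment> \<open>Whether or not the algorithm terminates on \<open>v\<close>, there are at most
      \<open>length v\<close> cells.\<close>
    obtain T' where T': "tower_diagram T'" "within D T'"
      "word_perm (tower_word D T' 1) = word_perm v" "card T' \<le> length v"
      using SR_word_perm[of v D] v(1) le by (fastforce split: if_splits)
    have "T = T'" using tower_eqI[OF T(1,2) T'(1,2)] T(3) T'(3) v(2) by simp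
    with T(4) T'(4) show ?thesis by simp
  qed
  then show "reduced_word \<alpha>"
    unfolding reduced_word_def perm_length_def
    by (intro Least_equality) (use assms in auto)
next
  assume red: "reduced_word \<alpha>"
  show "\<not> SR_terminates \<alpha>"
  proof
    assume terminates: "SR_terminates \<alpha>"
    define D where "D = Max (set (0 # \<alpha>))"
    have "a \<le> D" if "a \<in> set \<alpha>" for a
      unfolding D_def using that by (intro Max_ge) auto
    then obtain T where T: "tower_diagram T" "within D T"
      "word_perm (tower_word D T 1) = word_perm \<alpha>" "card T < length \<alpha>"
      using SR_word_perm[of \<alpha> D] assms terminates by (auto simp: SR_terminates_def)
    \<comment> \<open>The reading word of \<open>T\<close> is a shorter word for the same
      permutation.\<close>
    have "perm_length (word_perm \<alpha>) \<le> card T"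
      unfolding perm_length_def
      by (rule Least_le)
        (use T length_tower_word[OF T(1,2)] tower_word_ge in blast)
    with T(4) red show False by (simp add: reduced_word_def)
  qed
qed

end
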